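(* Let $A$ be a $\mathcal{U}(\mathfrak{h}_3(\mathbb{R}))$-module algebra, let $n\in\mathbb{Z}$, $\theta\in\Theta$ and $\theta'=\alpha_n(\theta)=\frac{\theta}{1+n\theta}$. Then $$(a\ast_{\theta'}b)\ast_\theta c=a\ast_{\theta'}(b\ast_\theta c)\qquad\text{for all } a,c\in A[[\nu]],\ b\in A_n[[\nu]].$$
   Context: $\mathfrak{h}_3(\mathbb{R})$ is the 3-dimensional Heisenberg Lie algebra with basis $\mathfrak{p},\mathfrak{q},\mathfrak{t}$, where $\mathfrak{t}$ is central and $[\mathfrak{p},\mathfrak{q}]=\mathfrak{t}$; $\mathcal{U}(\mathfrak{h}_3(\mathbb{R}))$ is its universal enveloping algebra with the standard Hopf algebra structure (elements of the Lie algebra are primitive). A $\mathcal{U}(\mathfrak{h}_3(\mathbb{R}))$-module algebra is a unital associative complex algebra $A$, with multiplication $m:A\otimes A\to A$, on which $\mathfrak{h}_3(\mathbb{R})$ acts by ($\mathbb{C}$-linear) derivations. For $n\in\mathbb{Z}$ put $A_n:=\{a\in A:\mathfrak{t}.a=na\}$. $\Theta:=\nu\,\mathbb{C}[[\nu]]$, and $\alpha_k(\theta):=\frac{\theta}{1+k\theta}=\theta-k\theta^2+\cdots\in\Theta$ for $k\in\mathbb{Z}$, $\theta\in\Theta$. For $\theta\in\Theta$ set $F_\theta:=\exp\{\theta\,\mathfrak{p}\otimes\mathfrak{q}\}$ and define the $\mathbb{C}[[\nu]]$-bilinear product on $A[[\nu]]$ by $a\ast_\theta b:=m\circ F_\theta^{-1}(a\otimes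 b)=\sum_{j\ge 0}\frac{(-\theta)^j}{j!}(\mathfrak{p}^j.a)(\mathfrak{q}^j.b)$ (with $m$ and the action extended $\mathbb{C}[[\nu]]$-linearly). *)

theory Defs
  imports
    "HOL-Analysis.Product_Vector"
    "HOL-Computational_Algebra.Formal_Power_Series"
begin

text \<open>
  The Heisenberg Lie algebra in coordinates: \<open>(x, y, z)\<close> stands for \<open>x p + y q + z t\<close>. Its bracket is
  the bilinear alternating map with \<open>[p, q] = t\<close> and \<open>t\<close> central.
\<close>

type_synonym heis = "real \<times> real \<times> real"

definition heis_p :: heis where "heis_p = (1, 0, 0)"
definition heis_q :: heis where "heis_q = (0, 1, 0)"
definition heis_t :: heis where "heis_t = (0, 0, 1)"

definition heis_bracket :: "heis \<Rightarrow> heis \<Rightarrow> heis" where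
  "heis_bracket = (\<lambda>(x, y, z) (x', y', z'). (0, 0, x * y' - y * x'))"

text \<open>
  The sort is \<open>{ring, monoid_mult}\<close> rather than \<open>ring_1\<close> because the latter imposes \<open>0 \<noteq> 1\<close>.
\<close>

locale complex_algebra = vector_space scl
  for scl :: "complex \<Rightarrow> 'a::{ring, monoid_mult} \<Rightarrow> 'a" +
  assumes scale_mult_left: "scl c a * b = scl c (a * b)"
    and scale_mult_right: "a * scl c b = scl c (a * b)"

text \<open>
  A module algebra over the enveloping algebra: since the Lie algebra generates the enveloping algebra
  and consists of primitive elements, the structure is a representation of the (real) Lie algebra by
  complex-linear derivations. The condition on the unit, \<open>x.1 = 0\<close>, is a consequence of the Leibniz rule.
\<close>

locale heisenberg_module_algebra = complex_algebra scl
  for scl :: "complex \<Rightarrow> 'a::{ring, monoid_mult} \<Rightarrow> 'a" +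
  fixes act :: "heis \<Rightarrow> 'a \<Rightarrow> 'a"
  assumes act_linear: "Vector_Spaces.linear scl scl (act x)"
    and act_leibniz: "act x (a * b) = act x a * b + a * act x b"
    and act_add: "act (x + y) a = act x a + act y a"
    and act_scaleR: "act (r *\<^sub>R x) a = scl (of_real r) (act x a)"
    and act_bracket: "act (heis_bracket x y) a = act x (act y a) - act y (act x a)"

definition weight_space ::
    "(complex \<Rightarrow> 'a \<Rightarrow> 'a) \<Rightarrow> (heis \<Rightarrow> 'a \<Rightarrow> 'a) \<Rightarrow> int \<Rightarrow> 'a set" where
  "weight_space scl act n = {a. act heis_t a = scl (of_int n) a}"

text \<open>\<open>fps_over S\<close> is the set \<open>S[[\<nu>]]\<close> of power series with all coefficients in \<open>S\<close>.\<close>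

definition fps_over :: "'a set \<Rightarrow> 'a fps set" where
  "fps_over S = {f. \<forall>k. fps_nth f k \<in> S}"

text \<open>The \<open>\<complex>[[\<nu>]]\<close>-linear extension of a complex-linear map acts coefficientwise.\<close>

definition fps_lift :: "('a \<Rightarrow> 'a) \<Rightarrow> 'a fps \<Rightarrow> 'a fps" where
  "fps_lift D f = Abs_fps (\<lambda>k. D (fps_nth f k))"

definition fps_scale ::
    "(complex \<Rightarrow> 'a \<Rightarrow> 'a) \<Rightarrow> complex fps \<Rightarrow> 'a::comm_monoid_add fps \<Rightarrow> 'a fps" where
  "fps_scale scl c f = Abs_fps (\<lambda>k. \<Sum>i\<le>k. scl (fps_nth c i) (fps_nth f (k - i)))"

definition Theta :: "complex fps set" where
  "Theta = {\<theta>. fps_nth \<theta> 0 = 0}"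

definition alpha :: "int \<Rightarrow> complex fps \<Rightarrow> complex fps" where
  "alpha k \<theta> = \<theta> / (1 + of_int k * \<theta>)"

text \<open>
  The multiplication of \<open>'a fps\<close> is the Cauchy product, i.e. the \<open>\<complex>[[\<nu>]]\<close>-bilinear extension of
  the multiplication \<open>m\<close> of the algebra. The sum is taken in the \<open>\<nu>\<close>-adic topology of \<open>'a fps\<close>; it converges for
  \<open>\<theta> \<in> Theta\<close>, see \<open>star_sums\<close> below. It is \<open>m\<close> applied to the exponential series of
  \<open>-\<theta> (p \<otimes> q)\<close>, evaluated at \<open>a \<otimes> b\<close>.
\<close>

definition star ::
    "(complex \<Rightarrow> 'a \<Rightarrow> 'a) \<Rightarrow> (heis \<Rightarrow> 'a \<Rightarrow> 'a) \<Rightarrow> complex fps \<Rightarrow>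
     'a::{ring, monoid_mult} fps \<Rightarrow> 'a fps \<Rightarrow> 'a fps" where
  "star scl act \<theta> a b =
     (\<Sum>j. fps_scale scl (fps_const (1 / fact j) * (- \<theta>) ^ j)
        (fps_lift (act heis_p ^^ j) a * fps_lift (act heis_q ^^ j) b))"

lemma alpha_mult:
  assumes "\<theta> \<in> Theta"
  shows "alpha k \<theta> * (1 + of_int k * \<theta>) = \<theta>"
proof -
  have "is_unit (1 + of_int k * \<theta>)"
    using assms by (simp add: Theta_def fps_is_unit_iff)
  then show ?thesis
    by (simp add: alpha_def)
qed

lemma alpha_in_Theta:
  assumes "\<theta> \<in> Theta"
  shows "alpha k \<theta> \<in> Theta"
  using arg_cong[OF alpha_mult[OF assms, of k], of "\<lambda>f. fps_nth f 0"] assms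
  by (simp add: Theta_def)

lemma (in complex_algebra) star_sums:
  assumes "\<theta> \<in> Theta"
  shows "(\<lambda>j. fps_scale scl (fps_const (1 / fact j) * (- \<theta>) ^ j)
           (fps_lift (act heis_p ^^ j) a * fps_lift (act heis_q ^^ j) b))
         sums star scl act \<theta> a b"
proof -
  let ?f = "\<lambda>j. fps_scale scl (fps_const (1 / fact j) * (- \<theta>) ^ j)
           (fps_lift (act heis_p ^^ j) a * fps_lift (act heis_q ^^ j) b)"
  have pow: "fps_nth ((- \<theta>) ^ j) i = 0" if "i < j" for i j
    using assms that by (intro startsby_zero_power_prefix[rule_format]) (auto simp: Theta_def)
  have z: "fps_nth (?f j) k = 0" if "k < j" for j k
    using that by (auto simp: fps_scale_def pow intro!: sum.neutral)
  define S where "S = Abs_fps (\<lambda>k. \<Sum>j\<le>k. fps_nth (?f j) k)"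
  have "?f sums S"
    unfolding sums_def
  proof (rule tendsto_fpsI)
    fix k
    have "fps_nth (\<Sum>j<n. ?f j) k = fps_nth S k" if "n > k" for n
    proof -
      have "(\<Sum>j<n. fps_nth (?f j) k) = (\<Sum>j\<le>k. fps_nth (?f j) k)"
        using that z by (intro sum.mono_neutral_right) auto
      then show ?thesis by (simp add: S_def fps_sum_nth)
    qed
    then show "\<forall>\<^sub>F n in sequentially. fps_nth (\<Sum>j<n. ?f j) k = fps_nth S k"
      by (rule eventually_mono[OF eventually_gt_at_top])
  qed
  then show ?thesis
    unfolding star_def by (simp add: sums_iff)
qed

end

(*
  Write p^k/k!, q^k/k! for divided powers, x = -\<theta> and y = -\<theta>', so that the relation
  \<theta>' = \<theta>/(1 + n \<theta>) becomes x + n x y = y. By the Leibniz rule both sides of the claim are triple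
  sums of terms p^_ a . (word in p, q applied to b) . q^_ c. On the right the word is q^u p^v. On the
  left it is p^k q^i, which on the weight space of b has the normal ordering
    p^k/k! q^i/i! b = \<Sum>s. n^s/s! q^(i-s)/(i-s)! p^(k-s)/(k-s)! b.
  After substituting it, p^m a and q^m c with the same excess m collect the coefficient
    \<Sum>s+l=m. (n x y)^s/s! x^l/l! = (x + n x y)^m/m! = y^m/m!,
  which is the coefficient on the right. Convergence is not an issue when everything is computed modulo
  \<nu>^(K+1), where all sums may be taken over boxes {..K}.
*)
theory Submission
  imports Defs
begin

section \<open>Congruence modulo \<nu>^(K+1)\<close>

definition eq_upto :: "nat \<Rightarrow> 'a::zero fps \<Rightarrow> 'a fps \<Rightarrow> bool" where
  "eq_upto K f g \<longleftrightarrow> (\<forall>k\<le>K. fps_nth f k = fps_nth g k)"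

lemma eq_upto_refl [simp]: "eq_upto K f f"
  by (simp add: eq_upto_def)

lemma eq_upto_sym: "eq_upto K f g \<Longrightarrow> eq_upto K g f"
  by (simp add: eq_upto_def)

lemma eq_upto_trans [trans]: "eq_upto K f g \<Longrightarrow> eq_upto K g h \<Longrightarrow> eq_upto K f h"
  by (simp add: eq_upto_def)

lemma fps_eq_if_eq_upto: "(\<And>K. eq_upto K f g) \<Longrightarrow> f = g"
  by (auto simp: eq_upto_def fps_eq_iff)

lemma eq_upto_sum:
  "(\<And>x. x \<in> A \<Longrightarrow> eq_upto K (f x) (g x)) \<Longrightarrow> eq_upto K (\<Sum>x\<in>A. f x) (\<Sum>x\<in>A. g x)"
  by (simp add: eq_upto_def fps_sum_nth)

lemma eq_upto_mult:
  assumes "eq_upto K f f'" "eq_upto K g g'"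
  shows "eq_upto K (f * g) (f' * g')"
  using assms by (auto simp: eq_upto_def fps_mult_nth intro!: sum.cong)

text \<open>Box and triangle differ only in the terms with \<open>k + l > K\<close>, which vanish
  modulo \<nu>^(K+1). Substitutions such as \<open>l = j - k\<close> in the truncated sums rest on
  this.\<close>

lemma eq_upto_sum_triangle:
  fixes f :: "nat \<Rightarrow> nat \<Rightarrow> 'a::comm_monoid_add fps"
  assumes "\<And>k l. k + l > K \<Longrightarrow> eq_upto K (f k l) 0"
  shows "eq_upto K (\<Sum>j\<le>K. \<Sum>k\<le>j. f k (j - k)) (\<Sum>k\<le>K. \<Sum>l\<le>K. f k l)"
  unfolding eq_upto_def
proof (intro allI impI)
  fix t assume t: "t \<le> K"
  have "fps_nth (\<Sum>k\<le>K. \<Sum>l\<le>K. f k l) t = (\<Sum>(k, l) \<in> {..K} \<times> {..K}. fps_nth (f k l) t)"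
    by (simp add: fps_sum_nth flip: sum.cartesian_product)
  also have "\<dots> = (\<Sum>(k, l) \<in> {(k, l). k + l \<le> K}. fps_nth (f k l) t)"
    using assms t by (intro sum.mono_neutral_right) (auto simp: eq_upto_def, meson not_le)
  also have "\<dots> = (\<Sum>j\<le>K. \<Sum>k\<le>j. fps_nth (f k (j - k)) t)"
    by (rule sum.triangle_reindex_eq)
  finally show "fps_nth (\<Sum>j\<le>K. \<Sum>k\<le>j. f k (j - k)) t = fps_nth (\<Sum>k\<le>K. \<Sum>l\<le>K. f k l) t"
    by (simp add: fps_sum_nth)
qed

lemma fps_lift_nth [simp]: "fps_nth (fps_lift D f) k = D (fps_nth f k)"
  by (simp add: fps_lift_def)

lemma fps_lift_funpow: "fps_lift (D ^^ j) = fps_lift D ^^ j"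
proof
  fix f show "fps_lift (D ^^ j) f = (fps_lift D ^^ j) f"
    by (induction j) (simp_all add: fps_eq_iff)
qed

lemma funpow_funpow: "(D ^^ j) ((D ^^ k) x) = (D ^^ (j + k)) x"
  by (simp add: funpow_add)

section \<open>Divided powers of complex power series\<close>

text \<open>In the normalisation x^k/k! the binomial coefficients of the Leibniz rule and of normal
  ordering are absorbed.\<close>

definition divpow :: "nat \<Rightarrow> complex fps \<Rightarrow> complex fps" where
  "divpow k x = fps_const (1 / fact k) * x ^ k"

lemma divpow_add: "divpow m (x + y) = (\<Sum>s\<le>m. divpow s x * divpow (m - s) y)"
proof -
  have "fps_const (1 / fact m) * of_nat (m choose s) = fps_const (1 / fact s) * fps_const (1 / fact (m - s) :: complex)"
    if "s \<le> m" for s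
    using that by (simp add: fps_of_nat [symmetric] binomial_fact field_simps)
  then show ?thesis
    by (auto simp: divpow_def binomial_ring sum_distrib_left mult_ac intro!: sum.cong)
qed

lemma binomial_mult_divpow:
  "s \<le> k \<Longrightarrow> of_nat (k choose s) * divpow k x = divpow s x * divpow (k - s) x"
proof -
  assume "s \<le> k"
  then have "of_nat (k choose s) * fps_const (1 / fact k)
      = fps_const (1 / fact s) * fps_const (1 / fact (k - s) :: complex)"
    by (simp add: fps_of_nat [symmetric] binomial_fact field_simps)
  then show ?thesis
    using \<open>s \<le> k\<close> by (simp add: divpow_def mult_ac flip: power_add)
qed

text \<open>The coefficient is the falling factorial i!/(i-s)!, which counts the ways to contract
  \<open>s\<close> operators p in succession with \<open>i\<close> operators q.\<close>

lemma divpow_mult_falling: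
  "s \<le> i \<Longrightarrow> of_nat (fact s * (i choose s)) * divpow i y = y ^ s * divpow (i - s) y"
proof -
  assume "s \<le> i"
  then have "of_nat (fact s * (i choose s)) * fps_const (1 / fact i) = fps_const (1 / fact (i - s) :: complex)"
    by (simp add: fps_of_nat [symmetric] binomial_fact field_simps)
  then show ?thesis
    using \<open>s \<le> i\<close> by (simp add: divpow_def mult_ac flip: power_add)
qed

lemma power_X_dvd_divpow:
  assumes "fps_X dvd x"
  shows "fps_X ^ k dvd divpow k x"
  unfolding divpow_def using dvd_power_same[OF assms] by (rule dvd_mult)

text \<open>Divisibility is multiplicative, so a product of divided powers has order at least the
  sum of their indices.\<close>

lemma Theta_iff_dvd: "x \<in> Theta \<longleftrightarrow> fps_X dvd x"
  by (cases "x = 0") (auto simp: Theta_def fps_dvd_iff Suc_le_eq subdegree_eq_0_iff simp flip: neq0_conv)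

section \<open>Power series over the algebra as a module over \<complex>[[\<nu>]]\<close>

context complex_algebra
begin

abbreviation fscale :: "complex fps \<Rightarrow> 'a fps \<Rightarrow> 'a fps" (infixr "\<star>" 75) where
  "c \<star> f \<equiv> fps_scale scl c f"

lemma fps_scale_nth: "fps_nth (c \<star> f) k = (\<Sum>i=0..k. scl (fps_nth c i) (fps_nth f (k - i)))"
  by (simp add: fps_scale_def atMost_atLeast0)

lemma fps_scale_mult_left: "(c \<star> f) * g = c \<star> (f * g)"
proof (rule fps_ext)
  fix k
  show "fps_nth ((c \<star> f) * g) k = fps_nth (c \<star> (f * g)) k"
    \<comment> \<open>Both sides sum over all ways to split \<open>k\<close> among \<open>c\<close>,
      \<open>f\<close> and \<open>g\<close>, so the reindexing is that of associativity of the
      Cauchy product.\<close>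
    using fps_mult_assoc_lemma[where n = k and k = k and f = "\<lambda>i j l. scl (fps_nth c i) (fps_nth f j * fps_nth g l)"]
    by (simp add: fps_scale_nth fps_mult_nth sum_distrib_right scale_sum_right scale_mult_left)
qed

lemma fps_scale_mult_right: "f * (c \<star> g) = c \<star> (f * g)"
proof (rule fps_ext)
  fix k
  have "fps_nth (f * (c \<star> g)) k
      = (\<Sum>i=0..k. \<Sum>j=0..k-i. scl (fps_nth c j) (fps_nth f i * fps_nth g (k - i - j)))"
    by (simp add: fps_scale_nth fps_mult_nth sum_distrib_left scale_mult_right)
  also have "\<dots> = (\<Sum>j=0..k. \<Sum>i=0..k-j. scl (fps_nth c j) (fps_nth f i * fps_nth g (k - j - i)))"
    unfolding sum.Sigma[OF finite_atLeastAtMost ballI[OF finite_atLeastAtMost]]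
    by (rule sum.reindex_bij_witness[where i = "\<lambda>(i, j). (j, i)" and j = "\<lambda>(i, j). (j, i)"])
       (auto simp: add.commute)
  finally show "fps_nth (f * (c \<star> g)) k = fps_nth (c \<star> (f * g)) k"
    by (simp add: fps_scale_nth fps_mult_nth scale_sum_right)
qed

text \<open>Only a module, since \<complex>[[\<nu>]] is a ring and not a field.\<close>

sublocale fps: module "fps_scale scl"
proof
  fix c d :: "complex fps" and f g :: "'a fps"
  show "c \<star> (f + g) = c \<star> f + c \<star> g"
    by (rule fps_ext) (simp add: fps_scale_nth scale_right_distrib sum.distrib)
  show "(c + d) \<star> f = c \<star> f + d \<star> f"
    by (rule fps_ext) (simp add: fps_scale_nth scale_left_distrib sum.distrib)
  show "c \<star> (d \<star> f) = (c * d) \<star> f"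
  proof (rule fps_ext)
    fix k
    show "fps_nth (c \<star> (d \<star> f)) k = fps_nth ((c * d) \<star> f) k"
      using fps_mult_assoc_lemma[where n = k and k = k and f = "\<lambda>i j l. scl (fps_nth c i * fps_nth d j) (fps_nth f l)"]
      by (simp add: fps_scale_nth fps_mult_nth scale_sum_left scale_sum_right)
  qed
  have "scl (fps_nth 1 i) x = (if i = 0 then x else 0)" for i x
    by simp
  then show "1 \<star> f = f"
    by (intro fps_ext) (simp add: fps_scale_nth sum.delta)
qed

lemma fps_scale_const_nth: "fps_nth (fps_const c \<star> f) k = scl c (fps_nth f k)"
proof -
  have "scl (fps_nth (fps_const c) i) x = (if i = 0 then scl c x else 0)" for i x
    by simp
  then show ?thesis
    by (simp add: fps_scale_nth sum.delta)
qed

lemma eq_upto_scale: "eq_upto K f g \<Longrightarrow> eq_upto K (c \<star> f) (c \<star> g)"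
  by (simp add: eq_upto_def fps_scale_nth)

text \<open>The tail estimate: a scalar of order above \<open>K\<close> kills every series modulo
  \<nu>^(K+1).\<close>

lemma eq_upto_scale_0:
  assumes "fps_X ^ N dvd c" "K < N"
  shows "eq_upto K (c \<star> f) 0"
proof -
  obtain d where "c = fps_X ^ N * d"
    using assms(1) by (elim dvdE)
  then have "fps_nth c i = 0" if "i \<le> K" for i
    using that assms(2) by (simp add: fps_X_power_mult_nth)
  then show ?thesis
    by (simp add: eq_upto_def fps_scale_nth)
qed

end

section \<open>A binomial formula for iterated operators\<close>

text \<open>Covers both the Leibniz rule for powers of a derivation and the normal ordering of \<open>p\<^sup>k q\<^sup>i\<close>.\<close>

lemma (in module) funpow_binomial:
  assumes add: "\<And>x y. D (x + y) = D x + D y"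
    and scl: "\<And>c x. D (scale c x) = scale c (D x)"
    and h: "\<And>s l. D (h s l) = h s (Suc l) + h (Suc s) l"
  shows "(D ^^ k) (h 0 0) = (\<Sum>s\<le>k. scale (of_nat (k choose s)) (h s (k - s)))"
proof (induction k)
  case (Suc k)
  have D0: "D 0 = 0"
    using scl[of 0 0] by simp
  have D_sum: "D (sum f A) = (\<Sum>x\<in>A. D (f x))" if "finite A" for f :: "nat \<Rightarrow> 'b" and A
    using that by induction (simp_all add: D0 add)
  \<comment> \<open>Pascal's rule splits \<open>Suc k choose Suc s\<close>, and
    \<open>g (Suc s)\<close> is the half with \<open>k choose Suc s\<close>. The isolated term
    \<open>h 0 (Suc k)\<close> is \<open>g 0\<close>, and \<open>g (Suc k)\<close> is zero.\<close>
  define g where "g s = scale (of_nat (k choose s)) (h s (Suc k - s))" for s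
  have "(\<Sum>s\<le>Suc k. scale (of_nat (Suc k choose s)) (h s (Suc k - s)))
      = h 0 (Suc k) + (\<Sum>s\<le>k. scale (of_nat (k choose s)) (h (Suc s) (k - s)) + g (Suc s))"
    by (subst sum.atMost_Suc_shift) (simp add: g_def scale_left_distrib)
  also have "\<dots> = (\<Sum>s\<le>k. scale (of_nat (k choose s)) (h (Suc s) (k - s))) + (\<Sum>s\<le>Suc k. g s)"
    by (subst sum.atMost_Suc_shift) (simp add: sum.distrib g_def ac_simps)
  also have "(\<Sum>s\<le>Suc k. g s) = (\<Sum>s\<le>k. scale (of_nat (k choose s)) (h s (Suc (k - s))))"
    by (simp add: g_def Suc_diff_le binomial_eq_0)
  finally show ?case
    by (simp add: Suc.IH D_sum scl h scale_right_distrib sum.distrib add.commute)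
qed simp

section \<open>Leibniz rule and normal ordering for the Heisenberg action\<close>

context heisenberg_module_algebra
begin

abbreviation "P \<equiv> fps_lift (act heis_p)"
abbreviation "Q \<equiv> fps_lift (act heis_q)"
abbreviation "T \<equiv> fps_lift (act heis_t)"

lemma act_plus: "act x (a + b) = act x a + act x b"
  and act_scl: "act x (scl c a) = scl c (act x a)"
  using act_linear[of x]
  by (simp_all add: Vector_Spaces.linear_iff)

lemma act_sum: "act x (sum f A) = (\<Sum>i\<in>A. act x (f i))"
  using act_plus[of x 0 0]
  by (induction A rule: infinite_finite_induct) (simp_all add: act_plus)

lemma lift_plus: "fps_lift (act x) (f + g) = fps_lift (act x) f + fps_lift (act x) g"
  by (simp add: fps_eq_iff act_plus)

lemma lift_scale: "fps_lift (act x) (c \<star> f) = c \<star> fps_lift (act x) f"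
  by (simp add: fps_eq_iff fps_scale_nth act_sum act_scl)

lemma lift_mult: "fps_lift (act x) (f * g) = fps_lift (act x) f * g + f * fps_lift (act x) g"
  by (simp add: fps_eq_iff fps_mult_nth act_sum act_leibniz sum.distrib)

lemma lift_bracket:
  "fps_lift (act x) (fps_lift (act y) f) = fps_lift (act y) (fps_lift (act x) f) + fps_lift (act (heis_bracket x y)) f"
  by (simp add: fps_eq_iff act_bracket)

lemma P_Q: "P (Q f) = Q (P f) + T f"
  using lift_bracket[of heis_p heis_q f]
  by (simp add: heis_bracket_def heis_p_def heis_q_def heis_t_def)

lemma T_central: "T (fps_lift (act x) f) = fps_lift (act x) (T f)"
proof -
  have "heis_bracket heis_t x = 0"
    by (cases x) (simp add: heis_bracket_def heis_t_def zero_prod_def)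
  moreover have "act 0 a = 0" for a
    using act_add[of 0 0 a] by simp
  ultimately show ?thesis
    using lift_bracket[of heis_t x f] by (simp add: fps_eq_iff)
qed

lemma lift_pow_plus:
    "(fps_lift (act x) ^^ j) (f + g) = (fps_lift (act x) ^^ j) f + (fps_lift (act x) ^^ j) g"
  and lift_pow_scale: "(fps_lift (act x) ^^ j) (c \<star> f) = c \<star> (fps_lift (act x) ^^ j) f"
  by (induction j) (simp_all add: lift_plus lift_scale)

lemma lift_pow_sum: "(fps_lift (act x) ^^ j) (sum f A) = (\<Sum>i\<in>A. (fps_lift (act x) ^^ j) (f i))"
  using lift_pow_plus[of j x 0 0]
  by (induction A rule: infinite_finite_induct) (simp_all add: lift_pow_plus)

lemma eq_upto_lift_pow:
  "eq_upto K f g \<Longrightarrow> eq_upto K ((fps_lift (act x) ^^ j) f) ((fps_lift (act x) ^^ j) g)"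
  by (simp add: eq_upto_def flip: fps_lift_funpow)

text \<open>In \<open>h s l\<close> the first alternative was taken \<open>l\<close> times and the
  second \<open>s\<close> times; the divided power absorbs the number of orders in which this can
  happen.\<close>

lemma divpow_scale_funpow:
  assumes "\<And>s l. fps_lift (act x) (h s l) = h s (Suc l) + h (Suc s) l"
  shows "divpow k z \<star> (fps_lift (act x) ^^ k) (h 0 0)
    = (\<Sum>s\<le>k. (divpow s z * divpow (k - s) z) \<star> h s (k - s))"
proof -
  have "(divpow k z * of_nat (k choose s)) \<star> f = (divpow s z * divpow (k - s) z) \<star> f" if "s \<le> k" for s f
    using binomial_mult_divpow[OF that] by (simp add: mult.commute)
  then show ?thesis
    using fps.funpow_binomial[of "fps_lift (act x)" h k, OF lift_plus lift_scale assms]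
    by (simp add: fps.scale_sum_right)
qed

text \<open>The index \<open>s\<close> counts the operators falling on the right factor, in
  \<open>divpow_leibniz'\<close> those on the left. In each application this is the factor
  containing \<open>b\<close>.\<close>

lemma divpow_leibniz:
  "divpow k z \<star> (fps_lift (act x) ^^ k) (f * g)
    = (\<Sum>s\<le>k. (divpow s z * divpow (k - s) z) \<star>
        ((fps_lift (act x) ^^ (k - s)) f * (fps_lift (act x) ^^ s) g))"
  using divpow_scale_funpow[of x "\<lambda>s l. (fps_lift (act x) ^^ l) f * (fps_lift (act x) ^^ s) g" k z]
  by (simp add: lift_mult)

lemma divpow_leibniz':
  "divpow k z \<star> (fps_lift (act x) ^^ k) (f * g)
    = (\<Sum>s\<le>k. (divpow s z * divpow (k - s) z) \<star>
        ((fps_lift (act x) ^^ s) f * (fps_lift (act x) ^^ (k - s)) g))"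
  using divpow_scale_funpow[of x "\<lambda>s l. (fps_lift (act x) ^^ s) f * (fps_lift (act x) ^^ l) g" k z]
  by (simp add: lift_mult add.commute)

text \<open>Since t is central, p and q preserve its eigenvectors, so every commutator met during
  normal ordering is the same scalar \<open>c\<close>.\<close>

lemma T_lift_pow:
  assumes "T f = c \<star> f"
  shows "T ((fps_lift (act x) ^^ j) f) = c \<star> (fps_lift (act x) ^^ j) f"
  using assms by (induction j) (simp_all add: T_central lift_scale)

text \<open>Each of the \<open>i\<close> operators q that p passes contributes one commutator t,
  acting as \<open>c\<close>.\<close>

lemma P_Q_pow:
  assumes "T f = c \<star> f"
  shows "P ((Q ^^ i) f) = (Q ^^ i) (P f) + (of_nat i * c) \<star> (Q ^^ (i - 1)) f"
proof (induction i)
  case (Suc i)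
  \<comment> \<open>For \<open>i = 0\<close> the exponent \<open>i - 1\<close> is truncated, but the
    factor \<open>of_nat i\<close> is then zero.\<close>
  have "(of_nat i * c) \<star> Q ((Q ^^ (i - 1)) f) = (of_nat i * c) \<star> (Q ^^ i) f"
    by (cases i) simp_all
  then show ?case
    by (simp add: P_Q T_lift_pow[OF assms] Suc.IH lift_plus lift_scale algebra_simps)
qed simp

text \<open>The operators p move to the right one at a time, and \<open>s\<close> of them are
  contracted with some q. Each contraction uses up one p and one q and contributes
  \<open>x * y * c\<close>. The case distinction excludes \<open>s > i\<close>, where
  \<open>i - s\<close> is truncated.\<close>

lemma divpow_normal_order:
  assumes "T f = c \<star> f"
  shows "(divpow k x * divpow i y) \<star> (P ^^ k) ((Q ^^ i) f) =
    (\<Sum>s\<le>k. if s \<le> i then (divpow s (x * y * c) * divpow (k - s) x * divpow (i - s) y) \<star>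
       (Q ^^ (i - s)) ((P ^^ (k - s)) f) else 0)"
proof -
  \<comment> \<open>The state after \<open>s\<close> contractions and \<open>l\<close> free
    passages. The falling factorial makes it vanish for \<open>s > i\<close>.\<close>
  define h where "h s l = (of_nat (fact s * (i choose s)) * c ^ s) \<star> (Q ^^ (i - s)) ((P ^^ l) f)" for s l
  have "P (h s l) = h s (Suc l) + h (Suc s) l" for s l
  proof -
    \<comment> \<open>One more contraction chooses among the \<open>i - s\<close> remaining
      operators q, which extends the falling factorial by a factor.\<close>
    have "(i - s) * (i choose s) = Suc s * (i choose Suc s)"
      by (simp only: binomial_absorb_comp binomial_absorption)
    then have "fact s * (i choose s) * (i - s) = fact (Suc s) * (i choose Suc s)"
      by (simp add: algebra_simps)
    then have coeff: "of_nat (fact s * (i choose s)) * c ^ s * (of_nat (i - s) * c)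
        = of_nat (fact (Suc s) * (i choose Suc s)) * c ^ Suc s"
      by (metis (no_types, lifting) mult.assoc mult.commute of_nat_mult power_Suc)
    show ?thesis
      unfolding h_def lift_scale P_Q_pow[OF T_lift_pow[OF assms]] fps.scale_right_distrib fps.scale_scale coeff
      by simp
  qed
  note expand = divpow_scale_funpow[of heis_p h k x, OF this]
  have summand: "(divpow i y * divpow s x * divpow (k - s) x) \<star> h s (k - s) =
      (if s \<le> i then (divpow s (x * y * c) * divpow (k - s) x * divpow (i - s) y) \<star>
       (Q ^^ (i - s)) ((P ^^ (k - s)) f) else 0)" for s
  proof (cases "s \<le> i")
    case True
    \<comment> \<open>The factor \<open>y ^ s\<close> released by \<open>divpow i y\<close> joins
      \<open>divpow s x\<close> and \<open>c ^ s\<close> to form the divided power of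
      \<open>x * y * c\<close>.\<close>
    have "divpow i y * divpow s x * divpow (k - s) x * (of_nat (fact s * (i choose s)) * c ^ s)
        = divpow s x * divpow (k - s) x * c ^ s * (of_nat (fact s * (i choose s)) * divpow i y)"
      by (simp only: mult_ac)
    also have "\<dots> = divpow s (x * y * c) * divpow (k - s) x * divpow (i - s) y"
      unfolding divpow_mult_falling[OF True] by (simp add: divpow_def power_mult_distrib mult_ac)
    finally have coeff: "divpow i y * divpow s x * divpow (k - s) x * (of_nat (fact s * (i choose s)) * c ^ s)
        = divpow s (x * y * c) * divpow (k - s) x * divpow (i - s) y" .
    show ?thesis
      unfolding h_def fps.scale_scale coeff using True by simp
  qed (simp add: h_def binomial_eq_0)
  have "(divpow k x * divpow i y) \<star> (P ^^ k) ((Q ^^ i) f) = divpow i y \<star> (divpow k x \<star> (P ^^ k) (h 0 0))"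
    by (simp add: h_def mult.commute)
  also have "\<dots> = (\<Sum>s\<le>k. (divpow i y * divpow s x * divpow (k - s) x) \<star> h s (k - s))"
    by (simp add: expand fps.scale_sum_right mult.assoc)
  finally show ?thesis
    by (simp only: summand)
qed

section \<open>Truncated star products\<close>

text \<open>The \<open>j\<close>-th term of the series has order at least \<open>j\<close>, because
  \<theta> has no constant term.\<close>

lemma eq_upto_star:
  assumes "\<theta> \<in> Theta"
  shows "eq_upto K (star scl act \<theta> a b)
    (\<Sum>j\<le>K. divpow j (- \<theta>) \<star> ((P ^^ j) a * (Q ^^ j) b))"
proof -
  define t where "t = (\<lambda>j. divpow j (- \<theta>) \<star> ((P ^^ j) a * (Q ^^ j) b))"
  have "t sums star scl act \<theta> a b"
    using star_sums[OF assms, of act a b] by (simp add: t_def divpow_def fps_lift_funpow)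
  then have lim: "(\<lambda>n. sum t {..<n}) \<longlonglongrightarrow> star scl act \<theta> a b"
    by (simp add: sums_def)
  have "fps_nth (star scl act \<theta> a b) k = fps_nth (sum t {..K}) k" if "k \<le> K" for k
  proof -
    have "\<forall>\<^sub>F n in sequentially. fps_nth (sum t {..<n}) k = fps_nth (star scl act \<theta> a b) k"
      using lim unfolding tendsto_fps_iff by blast
    then obtain N where N: "\<And>n. n \<ge> N \<Longrightarrow> fps_nth (sum t {..<n}) k = fps_nth (star scl act \<theta> a b) k"
      by (auto simp: eventually_sequentially)
    have "fps_nth (t j) k = 0" if "j > K" for j
      using eq_upto_scale_0[OF power_X_dvd_divpow, of "- \<theta>" K j] assms that \<open>k \<le> K\<close>
      by (simp add: t_def eq_upto_def Theta_iff_dvd)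
    \<comment> \<open>The bound \<open>N + Suc K\<close> lies beyond both the stabilisation index
      \<open>N\<close> and the cutoff \<open>K\<close>.\<close>
    then have "(\<Sum>j<N + Suc K. fps_nth (t j) k) = (\<Sum>j\<le>K. fps_nth (t j) k)"
      by (intro sum.mono_neutral_right) auto
    then show ?thesis
      using N[of "N + Suc K"] by (simp add: fps_sum_nth)
  qed
  then show ?thesis
    by (simp add: eq_upto_def t_def)
qed

text \<open>
  The summand of the left-hand side after normal ordering, with \<open>w\<close> standing for \<open>n x y\<close>, and the
  summand of the right-hand side.
\<close>

definition left_summand :: "complex fps \<Rightarrow> complex fps \<Rightarrow> complex fps \<Rightarrow> 'a fps \<Rightarrow> 'a fps \<Rightarrow> 'a fps \<Rightarrow>
    nat \<Rightarrow> nat \<Rightarrow> nat \<Rightarrow> nat \<Rightarrow> 'a fps" where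
  "left_summand x y w a b c s l u v = (divpow l x * divpow s w * divpow v x * divpow u y) \<star>
     ((P ^^ (s + l + u)) a * ((Q ^^ u) ((P ^^ v) b) * (Q ^^ (s + l + v)) c))"

definition right_summand :: "complex fps \<Rightarrow> complex fps \<Rightarrow> 'a fps \<Rightarrow> 'a fps \<Rightarrow> 'a fps \<Rightarrow>
    nat \<Rightarrow> nat \<Rightarrow> nat \<Rightarrow> 'a fps" where
  "right_summand x y a b c m u v = (divpow m y * divpow v x * divpow u y) \<star>
     ((P ^^ (m + u)) a * ((Q ^^ u) ((P ^^ v) b) * (Q ^^ (m + v)) c))"

lemma eq_upto_left_summand_0:
  assumes "fps_X dvd x" "fps_X dvd y" "fps_X dvd w" "K < l + s + v + u"
  shows "eq_upto K (left_summand x y w a b c s l u v) 0"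
proof -
  have "fps_X ^ (l + s + v + u) dvd divpow l x * divpow s w * divpow v x * divpow u y"
    unfolding power_add using assms by (intro mult_dvd_mono power_X_dvd_divpow)
  then show ?thesis
    unfolding left_summand_def using assms(4) by (rule eq_upto_scale_0)
qed

lemma eq_upto_right_summand_0:
  assumes "fps_X dvd x" "fps_X dvd y" "K < m + v + u"
  shows "eq_upto K (right_summand x y a b c m u v) 0"
proof -
  have "fps_X ^ (m + v + u) dvd divpow m y * divpow v x * divpow u y"
    unfolding power_add using assms by (intro mult_dvd_mono power_X_dvd_divpow)
  then show ?thesis
    unfolding right_summand_def using assms(3) by (rule eq_upto_scale_0)
qed

text \<open>The key cancellation: \<open>s\<close> and \<open>l = m - s\<close> enter the operators
  only through their sum \<open>m\<close>, so the scalars add up to the divided power of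
  \<open>x + w\<close>, which is \<open>y\<close>.\<close>

lemma sum_left_summand:
  assumes "x + w = y"
  shows "(\<Sum>s\<le>m. left_summand x y w a b c s (m - s) u v) = right_summand x y a b c m u v"
proof -
  have "divpow m y = (\<Sum>s\<le>m. divpow (m - s) x * divpow s w)"
    using divpow_add[of m w x] assms by (simp add: mult.commute add.commute)
  then show ?thesis
    by (simp add: right_summand_def left_summand_def sum_distrib_right fps.scale_sum_left)
qed

section \<open>The two iterated products\<close>

text \<open>Of the \<open>j\<close> operators q in the outer product, \<open>u\<close> fall on p^v b
  and \<open>m = j - u\<close> on \<open>c\<close>, so the word applied to \<open>b\<close> is
  already in normal order.\<close>

lemma star_star_right:
  assumes "\<theta> \<in> Theta" "\<theta>' \<in> Theta"
  shows "eq_upto K (star scl act \<theta>' a (star scl act \<theta> b c))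
    (\<Sum>u\<le>K. \<Sum>v\<le>K. \<Sum>m\<le>K. right_summand (- \<theta>) (- \<theta>') a b c m u v)"
proof -
  define x y where "x = - \<theta>" and "y = - \<theta>'"
  have X: "fps_X dvd x" "fps_X dvd y"
    using assms by (simp_all add: x_def y_def Theta_iff_dvd)
  have "eq_upto K (star scl act \<theta>' a (star scl act \<theta> b c))
      (\<Sum>j\<le>K. divpow j y \<star> ((P ^^ j) a * (Q ^^ j) (\<Sum>v\<le>K. divpow v x \<star> ((P ^^ v) b * (Q ^^ v) c))))"
    unfolding x_def y_def
    by (rule eq_upto_trans[OF eq_upto_star[OF assms(2)]])
       (intro eq_upto_sum eq_upto_scale eq_upto_mult eq_upto_refl eq_upto_lift_pow eq_upto_star[OF assms(1)])
  also have "(\<Sum>j\<le>K. divpow j y \<star> ((P ^^ j) a * (Q ^^ j) (\<Sum>v\<le>K. divpow v x \<star> ((P ^^ v) b * (Q ^^ v) c))))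
      = (\<Sum>j\<le>K. \<Sum>v\<le>K. divpow v x \<star> ((P ^^ j) a * (divpow j y \<star> (Q ^^ j) ((P ^^ v) b * (Q ^^ v) c))))"
    by (simp add: lift_pow_sum lift_pow_scale sum_distrib_left fps.scale_sum_right fps_scale_mult_right mult.commute)
  also have "\<dots> = (\<Sum>v\<le>K. \<Sum>j\<le>K. \<Sum>u\<le>j. right_summand x y a b c (j - u) u v)"
    unfolding divpow_leibniz'
    by (subst sum.swap)
       (auto simp: right_summand_def sum_distrib_left fps.scale_sum_right fps_scale_mult_right
          funpow_funpow mult_ac intro!: sum.cong)
  also have "eq_upto K \<dots> (\<Sum>v\<le>K. \<Sum>u\<le>K. \<Sum>m\<le>K. right_summand x y a b c m u v)"
    using X by (intro eq_upto_sum eq_upto_sum_triangle[where f = "\<lambda>u m. right_summand x y a b c m u _"] eq_upto_right_summand_0) auto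
  also have "\<dots> = (\<Sum>u\<le>K. \<Sum>v\<le>K. \<Sum>m\<le>K. right_summand x y a b c m u v)"
    by (rule sum.swap)
  finally show ?thesis
    by (simp add: x_def y_def)
qed

text \<open>The relation between \<theta> and \<theta>' has its denominator cleared; after the sign
  change it reads \<open>x + w = y\<close>.\<close>

lemma star_star_left:
  assumes "\<theta> \<in> Theta" "\<theta>' \<in> Theta" and b: "T b = d \<star> b" and "\<theta> - \<theta> * \<theta>' * d = \<theta>'"
  shows "eq_upto K (star scl act \<theta> (star scl act \<theta>' a b) c)
    (\<Sum>u\<le>K. \<Sum>v\<le>K. \<Sum>m\<le>K. right_summand (- \<theta>) (- \<theta>') a b c m u v)"
proof -
  define x y w where "x = - \<theta>" and "y = - \<theta>'" and "w = x * y * d"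
  have X: "fps_X dvd x" "fps_X dvd y" "fps_X dvd w"
    using assms(1,2) by (simp_all add: x_def y_def w_def Theta_iff_dvd)
  have xw: "x + w = y"
    using assms(4) by (simp add: x_def y_def w_def algebra_simps)
  let ?t = "left_summand x y w a b c"
  have "eq_upto K (star scl act \<theta> (star scl act \<theta>' a b) c)
      (\<Sum>j\<le>K. divpow j x \<star> ((P ^^ j) (\<Sum>i\<le>K. divpow i y \<star> ((P ^^ i) a * (Q ^^ i) b)) * (Q ^^ j) c))"
    unfolding x_def y_def
    by (rule eq_upto_trans[OF eq_upto_star[OF assms(1)]])
       (intro eq_upto_sum eq_upto_scale eq_upto_mult eq_upto_refl eq_upto_lift_pow eq_upto_star[OF assms(2)])
  also have "(\<Sum>j\<le>K. divpow j x \<star> ((P ^^ j) (\<Sum>i\<le>K. divpow i y \<star> ((P ^^ i) a * (Q ^^ i) b)) * (Q ^^ j) c))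
      = (\<Sum>j\<le>K. \<Sum>i\<le>K. divpow i y \<star> ((divpow j x \<star> (P ^^ j) ((P ^^ i) a * (Q ^^ i) b)) * (Q ^^ j) c))"
    by (simp add: lift_pow_sum lift_pow_scale sum_distrib_right fps.scale_sum_right fps_scale_mult_left mult.commute)
  \<comment> \<open>Of the \<open>j\<close> operators p, \<open>k\<close> fall on q^i b and
    \<open>j - k\<close> on \<open>a\<close>. The exponent \<open>k + (j - k)\<close> stays
    unsimplified to exhibit the term as a function of \<open>k\<close> and
    \<open>l = j - k\<close>.\<close>
  also have "\<dots> = (\<Sum>i\<le>K. \<Sum>j\<le>K. \<Sum>k\<le>j. (divpow k x * divpow (j - k) x * divpow i y) \<star>
      ((P ^^ (j - k + i)) a * ((P ^^ k) ((Q ^^ i) b) * (Q ^^ (k + (j - k))) c)))"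
    unfolding divpow_leibniz
    by (subst sum.swap)
       (auto simp: sum_distrib_right fps.scale_sum_right fps_scale_mult_left
          funpow_funpow mult_ac intro!: sum.cong)
  also have "eq_upto K \<dots> (\<Sum>i\<le>K. \<Sum>k\<le>K. \<Sum>l\<le>K. (divpow k x * divpow l x * divpow i y) \<star>
      ((P ^^ (l + i)) a * ((P ^^ k) ((Q ^^ i) b) * (Q ^^ (k + l)) c)))"
  proof (rule eq_upto_sum, rule eq_upto_sum_triangle[where f = "\<lambda>k l. (divpow k x * divpow l x * divpow _ y) \<star>
      ((P ^^ (l + _)) a * ((P ^^ k) ((Q ^^ _) b) * (Q ^^ (k + l)) c))"])
    fix i k l :: nat
    have "fps_X ^ (k + l + i) dvd divpow k x * divpow l x * divpow i y"
      unfolding power_add using X by (intro mult_dvd_mono power_X_dvd_divpow)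
    moreover assume "K < k + l"
    ultimately show "eq_upto K ((divpow k x * divpow l x * divpow i y) \<star>
      ((P ^^ (l + i)) a * ((P ^^ k) ((Q ^^ i) b) * (Q ^^ (k + l)) c))) 0"
      by (rule eq_upto_scale_0[OF _ trans_less_add1])
  qed
  \<comment> \<open>Here the weight of \<open>b\<close> enters, through the normal ordering of p^k
    q^i b.\<close>
  also have "(\<Sum>i\<le>K. \<Sum>k\<le>K. \<Sum>l\<le>K. (divpow k x * divpow l x * divpow i y) \<star>
      ((P ^^ (l + i)) a * ((P ^^ k) ((Q ^^ i) b) * (Q ^^ (k + l)) c)))
      = (\<Sum>i\<le>K. \<Sum>k\<le>K. \<Sum>l\<le>K. \<Sum>s\<le>k. if s \<le> i then ?t s l (i - s) (k - s) else 0)"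
  proof (intro sum.cong refl)
    fix i k l
    have "(divpow k x * divpow l x * divpow i y) \<star>
        ((P ^^ (l + i)) a * ((P ^^ k) ((Q ^^ i) b) * (Q ^^ (k + l)) c))
      = divpow l x \<star> ((P ^^ (l + i)) a * (((divpow k x * divpow i y) \<star> (P ^^ k) ((Q ^^ i) b)) * (Q ^^ (k + l)) c))"
      by (simp add: fps_scale_mult_left fps_scale_mult_right mult_ac)
    also have "\<dots> = (\<Sum>s\<le>k. if s \<le> i then ?t s l (i - s) (k - s) else 0)"
      unfolding divpow_normal_order[OF b] sum_distrib_left sum_distrib_right fps.scale_sum_right
      by (intro sum.cong refl)
         (auto simp: left_summand_def w_def fps_scale_mult_left fps_scale_mult_right mult_ac add_ac)
    finally show "(divpow k x * divpow l x * divpow i y) \<star>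
        ((P ^^ (l + i)) a * ((P ^^ k) ((Q ^^ i) b) * (Q ^^ (k + l)) c))
      = (\<Sum>s\<le>k. if s \<le> i then ?t s l (i - s) (k - s) else 0)" .
  qed
  also have "\<dots> = (\<Sum>i\<le>K. \<Sum>l\<le>K. \<Sum>k\<le>K. \<Sum>s\<le>k. if s \<le> i then ?t s l (i - s) (k - s) else 0)"
    by (intro sum.cong refl sum.swap)
  \<comment> \<open>Substitutes \<open>v = k - s\<close>, the number of operators p left on
    \<open>b\<close>.\<close>
  also have "eq_upto K \<dots> (\<Sum>i\<le>K. \<Sum>l\<le>K. \<Sum>s\<le>K. \<Sum>v\<le>K. if s \<le> i then ?t s l (i - s) v else 0)"
    using X by (intro eq_upto_sum eq_upto_sum_triangle[where f = "\<lambda>s v. if s \<le> _ then ?t s _ (_ - s) v else 0"])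
      (auto intro!: eq_upto_left_summand_0)
  \<comment> \<open>The condition \<open>s \<le> i\<close> cuts the box in \<open>i\<close> and
    \<open>s\<close> down to a triangle, in preparation for \<open>u = i - s\<close>.\<close>
  also have "\<dots> = (\<Sum>l\<le>K. \<Sum>v\<le>K. \<Sum>i\<le>K. \<Sum>s\<le>i. ?t s l (i - s) v)"
  proof -
    have "(\<Sum>s\<le>K. if s \<le> i then g s else 0) = (\<Sum>s\<le>i. g s)" if "i \<le> K" for i and g :: "nat \<Rightarrow> 'a fps"
      using that by (intro sum.mono_neutral_cong_right) auto
    then show ?thesis
      by (subst sum.swap, subst (2) sum.swap, subst (2) sum.swap)
         (auto simp: intro!: sum.cong)
  qed
  also have "eq_upto K \<dots> (\<Sum>l\<le>K. \<Sum>v\<le>K. \<Sum>s\<le>K. \<Sum>u\<le>K. ?t s l u v)"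
    using X by (intro eq_upto_sum eq_upto_sum_triangle[where f = "\<lambda>s u. ?t s _ u _"])
      (auto intro!: eq_upto_left_summand_0)
  also have "\<dots> = (\<Sum>u\<le>K. \<Sum>v\<le>K. \<Sum>s\<le>K. \<Sum>l\<le>K. ?t s l u v)"
    by (simp add: sum.cartesian_product,
        rule sum.reindex_bij_witness[where i = "\<lambda>(u, v, s, l). (l, v, s, u)" and j = "\<lambda>(l, v, s, u). (u, v, s, l)"])
       auto
  \<comment> \<open>Groups the terms by the excess \<open>m = s + l\<close>, passing from the box
    back to the triangle.\<close>
  also have "eq_upto K \<dots> (\<Sum>u\<le>K. \<Sum>v\<le>K. \<Sum>m\<le>K. \<Sum>s\<le>m. ?t s (m - s) u v)"
    using X by (intro eq_upto_sum eq_upto_sym[OF eq_upto_sum_triangle[where f = "\<lambda>s l. ?t s l _ _"]])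
      (auto intro!: eq_upto_left_summand_0)
  finally show ?thesis
    by (simp add: sum_left_summand[OF xw] flip: x_def y_def)
qed

lemma star_assoc:
  assumes "\<theta> \<in> Theta" "\<theta>' = alpha n \<theta>" "b \<in> fps_over (weight_space scl act n)"
  shows "star scl act \<theta> (star scl act \<theta>' a b) c = star scl act \<theta>' a (star scl act \<theta> b c)"
proof -
  have \<theta>': "\<theta>' \<in> Theta" "\<theta>' * (1 + of_int n * \<theta>) = \<theta>"
    using alpha_in_Theta alpha_mult assms by auto
  have "\<theta> - \<theta> * \<theta>' * of_int n = \<theta>'"
    using \<theta>'(2) by (simp add: algebra_simps)
  \<comment> \<open>Here \<open>of_int n\<close> is a constant series, so scaling by it acts on each
    coefficient of \<open>b\<close> separately.\<close>
  moreover have "T b = of_int n \<star> b"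
    using assms(3)
    by (auto simp: fps_over_def weight_space_def fps_eq_iff fps_scale_const_nth simp flip: fps_of_int)
  ultimately show ?thesis
    using star_star_left star_star_right assms(1) \<theta>'(1)
    by (blast intro: fps_eq_if_eq_upto eq_upto_trans eq_upto_sym)
qed

end

theorem proposition3p2:
  fixes scl :: "complex \<Rightarrow> 'a::{ring, monoid_mult} \<Rightarrow> 'a"
    and act :: "heis \<Rightarrow> 'a \<Rightarrow> 'a"
    and n :: int
    and \<theta> \<theta>' :: "complex fps"
    and a b c :: "'a fps"
  assumes "heisenberg_module_algebra scl act"
    and "\<theta> \<in> Theta"
    and "\<theta>' = alpha n \<theta>"
    and "b \<in> fps_over (weight_space scl act n)"
  shows "star scl act \<theta> (star scl act \<theta>' a b) c = star scl act \<theta>' a (star scl act \<theta> b c)"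
  using heisenberg_module_algebra.star_assoc[OF assms] .

end
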